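(* Let $m_0\ge 1$, let $\lambda_{m_0}$ be a Dirichlet eigenvalue of $H_{m_0}$ and let $u_{m_0}\in\ell(V_{m_0})$ be a corresponding Dirichlet eigenfunction. For $m> m_0$ let $\lambda_m:=\phi_-^{\,m-m_0}(\lambda_{m_0})$ (the $(m-m_0)$-fold composition of $\phi_-$ applied to $\lambda_{m_0}$), a Dirichlet eigenvalue of $H_m$ with corresponding eigenfunction $u_m\in\ell(V_m)$ obtained by spectral decimation, i.e. $u_m|_{V_{m-1}}=u_{m-1}$ and $u_m(p)=\dfrac{u_{m-1}(b_m(p))}{1-\lambda_m}$ for $p\in V_m\setminus V_{m-1}$. Let $u:\Sigma_N^+\to\mathbb{R}$ be the extension of the functions $u_m$ to $\Sigma_N^+$ (defined in the context). Then the limit $$\lambda:=\lim_{m\to\infty}N^{m+1}\lambda_m$$ exists and is a Dirichlet eigenvalue of the Laplacian $\Delta$, with corresponding eigenfunction $u$; that is, $u\in D_\mu$, $\Delta u=-\lambda u$ on $\Sigma_N^+\setminus V_0$, and $u|_{V_0}=0$.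
   Context: Let $N>1$ be an integer, $S=\{1,\dots,N\}$, $\Sigma_N^+=S^{\mathbb{N}}$ (one-sided sequences $x=(x_1x_2\cdots)$) with metric $d(x,y)=2^{-\rho(x,y)}$, $\rho(x,y)=\min\{i:x_i\neq y_i\}$, $\rho(x,x)=\infty$. For $m\ge 0$, $V_m$ is the set of sequences constant from position $m+1$ on; its elements are written $(p_1\cdots p_m\dot p_{m+1})=(p_1\cdots p_m p_{m+1}p_{m+1}\cdots)$. Thus $V_0\subset V_1\subset\cdots$, $\#V_m=N^{m+1}$, and $p\in V_m\setminus V_{m-1}$ ($m\ge1$) iff $p_m\ne p_{m+1}$. Put $V_*=\bigcup_m V_m$. The set $V_0$ is regarded as the boundary. For $p\in V_m$, $\mathcal{U}_{p,m}=\{(p_1\cdots p_m\dot l):l\in S\}\setminus\{p\}$ ($N-1$ points). For $p\in V_m\setminus V_{m-1}$, $b_m(p)=(p_1\cdots p_{m-1}\dot p_m)$ is the unique element of $\mathcal{U}_{p,m}$ lying in $V_{m-1}$. $\ell(V_m)$ is the space of real functions on $V_m$. The difference operators $H_m:\ell(V_m)\to\ell(V_m)$ are given by $H_0u(p)=-(N-1)u(p)+\sum_{q\in\mathcal{U}_{p,0}}u(q)$ and, for $m\ge1$, $$H_mu(p)=\begin{cases}-(N-1)u(p)+\sum_{q\in\mathcal{U}_{p,m}}u(q), & p\in V_m\setminus V_{m-1},\\ H_{m-1}(u|_{V_{m-1}})(p)-(N-1)u(p)+\sum_{q\in\mathcal{U}_{p,m}}u(q), & p\in V_{m-1}.\end{cases}$$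 For a function $u$ on $\Sigma_N^+$, $H_mu$ means $H_m(u|_{V_m})$. For $m\ge1$, $\lambda_m\in\mathbb{R}$ is a Dirichlet eigenvalue of $H_m$ with Dirichlet eigenfunction $u_m\in\ell(V_m)$, $u_m\not\equiv0$, if $H_mu_m=-\lambda_mu_m$ on $V_m\setminus V_0$ and $u_m|_{V_0}=0$. $\phi_-(x)=\dfrac{(N+x)-\sqrt{(N+x)^2-4x}}{2}$. Laplacian: let $\mu$ be the Bernoulli measure on $\Sigma_N^+$ giving each cylinder $[p_1\cdots p_m]$ mass $N^{-m}$. $D_\mu$ is the set of $u\in\mathcal{C}(\Sigma_N^+)$ for which there is $f\in\mathcal{C}(\Sigma_N^+)$ with $$\lim_{m\to\infty}\max_{p\in V_m\setminus V_{m-1}}\left|\frac{H_mu(p)}{\mu([p_1\cdots p_{m+1}])}-f(p)\right|=0,$$ i.e. $\max_{p\in V_m\setminus V_{m-1}}|N^{m+1}H_mu(p)-f(p)|\to0$. Then $\Delta u:=f$. A real $\lambda$ is a Dirichlet eigenvalue of $\Delta$ with eigenfunction $u\not\equiv 0$ in $D_\mu$ if $\Delta u=-\lambda u$ on $\Sigma_N^+\setminus V_0$ and $u|_{V_0}=0$. Extension $u$: for $m<m_0$ let $u_m=u_{m_0}|_{V_m}$. If $x\in V_*$, $u(x)=u_m(x)$ with $m=\min\{i\ge0:x\in V_i\}$. If $x\in\Sigma_N^+\setminus V_*$, $u(x)=\lim_{k\to\infty}u_{m_k}(p^{m_k})$ for any sequence $p^{m_k}\in V_{m_k}\setminus V_{m_k-1}$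 converging to $x$ (the limit exists and is independent of the sequence). *)

theory Defs
  imports "HOL-Probability.Probability"
begin

text \<open>
  A sequence \<open>x = (x\<^sub>1 x\<^sub>2 \<dots>)\<close> is a function on \<open>nat\<close> that is extensional on \<open>{1..}\<close>, so that
  \<open>x i\<close> is the symbol in position \<open>i\<close> (counting from 1) and \<open>x 0\<close> carries no information.
\<close>

type_synonym seq = "nat \<Rightarrow> nat"

definition shift_space :: "nat \<Rightarrow> seq set" where
  "shift_space N = {1..} \<rightarrow>\<^sub>E {1..N}"

definition seq_dist :: "seq \<Rightarrow> seq \<Rightarrow> real" where
  "seq_dist x y = (if x = y then 0 else (1/2) ^ (LEAST i. x i \<noteq> y i))"

definition shift_topology :: "nat \<Rightarrow> seq topology" where
  "shift_topology N = Metric_space.mtopology (shift_space N) seq_dist"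

text \<open>The sequence \<open>(p\<^sub>1 \<dots> p\<^sub>m l l l \<dots>)\<close>.\<close>

definition dotted :: "nat \<Rightarrow> seq \<Rightarrow> nat \<Rightarrow> seq" where
  "dotted m p l = restrict (\<lambda>i. if i \<le> m then p i else l) {1..}"

definition V :: "nat \<Rightarrow> nat \<Rightarrow> seq set" where
  "V N m = {x \<in> shift_space N. \<forall>i\<ge>m+1. x i = x (m+1)}"

definition V_star :: "nat \<Rightarrow> seq set" where
  "V_star N = (\<Union>m. V N m)"

definition nbrs :: "nat \<Rightarrow> seq \<Rightarrow> nat \<Rightarrow> seq set" where
  "nbrs N p m = {dotted m p l | l. l \<in> {1..N}} - {p}"

definition parent :: "nat \<Rightarrow> seq \<Rightarrow> seq" where
  "parent m p = dotted (m - 1) p (p m)"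

text \<open>
  A real function on \<open>V N m\<close> is represented by any function on sequences; \<open>H N m u\<close> on \<open>V N m\<close>
  uses the values of \<open>u\<close> on \<open>V N m\<close> only, so restriction to a smaller \<open>V N k\<close> is implicit.
\<close>

primrec H :: "nat \<Rightarrow> nat \<Rightarrow> (seq \<Rightarrow> real) \<Rightarrow> seq \<Rightarrow> real" where
  "H N 0 u p = - (real N - 1) * u p + (\<Sum>q\<in>nbrs N p 0. u q)"
| "H N (Suc m) u p =
     (if p \<in> V N m
      then H N m u p - (real N - 1) * u p + (\<Sum>q\<in>nbrs N p (Suc m). u q)
      else - (real N - 1) * u p + (\<Sum>q\<in>nbrs N p (Suc m). u q))"

definition H_dirichlet_eigenpair :: "nat \<Rightarrow> nat \<Rightarrow> real \<Rightarrow> (seq \<Rightarrow> real) \<Rightarrow> bool" where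
  "H_dirichlet_eigenpair N m lam u \<longleftrightarrow>
     (\<exists>p\<in>V N m. u p \<noteq> 0) \<and>
     (\<forall>p\<in>V N m - V N 0. H N m u p = - lam * u p) \<and>
     (\<forall>p\<in>V N 0. u p = 0)"

definition phi_minus :: "nat \<Rightarrow> real \<Rightarrow> real" where
  "phi_minus N x = ((real N + x) - sqrt ((real N + x)\<^sup>2 - 4 * x)) / 2"

definition bernoulli_measure :: "nat \<Rightarrow> seq measure" where
  "bernoulli_measure N = PiM {1..} (\<lambda>_. uniform_count_measure {1..N})"

definition cylinder :: "nat \<Rightarrow> nat \<Rightarrow> seq \<Rightarrow> seq set" where
  "cylinder N m p = {x \<in> shift_space N. \<forall>i\<in>{1..m}. x i = p i}"

text \<open>
  The term \<open>m = 0\<close> of the sequence below, a maximum over the empty set, is irrelevant for the limit.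
\<close>

definition has_laplacian :: "nat \<Rightarrow> (seq \<Rightarrow> real) \<Rightarrow> (seq \<Rightarrow> real) \<Rightarrow> bool" where
  "has_laplacian N u f \<longleftrightarrow>
     continuous_map (shift_topology N) euclideanreal f \<and>
     (\<lambda>m. MAX p\<in>V N m - V N (m - 1).
        \<bar>H N m u p / measure (bernoulli_measure N) (cylinder N (m+1) p) - f p\<bar>) \<longlonglongrightarrow> 0"

definition D_mu :: "nat \<Rightarrow> (seq \<Rightarrow> real) set" where
  "D_mu N = {u. continuous_map (shift_topology N) euclideanreal u \<and> (\<exists>f. has_laplacian N u f)}"

text \<open>
  The choice below only concerns values outside the shift space, see \<open>has_laplacian_unique\<close>.
\<close>

definition laplacian :: "nat \<Rightarrow> (seq \<Rightarrow> real) \<Rightarrow> seq \<Rightarrow> real" where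
  "laplacian N u = (SOME f. has_laplacian N u f)"

definition laplacian_dirichlet_eigenpair :: "nat \<Rightarrow> real \<Rightarrow> (seq \<Rightarrow> real) \<Rightarrow> bool" where
  "laplacian_dirichlet_eigenpair N lam u \<longleftrightarrow>
     u \<in> D_mu N \<and>
     (\<exists>x\<in>shift_space N. u x \<noteq> 0) \<and>
     (\<forall>x\<in>shift_space N - V N 0. laplacian N u x = - lam * u x) \<and>
     (\<forall>x\<in>V N 0. u x = 0)"

text \<open>
  Off \<open>V_star N\<close> the value is the common limit of \<open>um (mk k) (p k)\<close> over all admissible sequences
  \<open>p\<close> converging to \<open>x\<close>. For such \<open>x\<close>, convergence forces \<open>mk\<close> to tend to infinity; moreover
  \<open>mk k \<noteq> 0\<close> because \<open>V N 0 - V N (0 - 1)\<close> is empty.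
\<close>

definition extension :: "nat \<Rightarrow> (nat \<Rightarrow> seq \<Rightarrow> real) \<Rightarrow> seq \<Rightarrow> real" where
  "extension N um x =
     (if x \<in> V_star N then um (LEAST i. x \<in> V N i) x
      else (THE l. \<forall>mk p.
              (\<forall>k. p k \<in> V N (mk k) - V N (mk k - 1)) \<longrightarrow>
              limitin (shift_topology N) p x sequentially \<longrightarrow>
              (\<lambda>k. um (mk k) (p k)) \<longlonglongrightarrow> l))"

lemma seq_dist_less_iff:
  assumes "x \<in> shift_space N" "y \<in> shift_space N"
  shows "seq_dist x y < (1/2) ^ n \<longleftrightarrow> (\<forall>i\<in>{1..n}. x i = y i)"
proof (cases "x = y")
  case False
  have x0: "x 0 = y 0"
    using assms by (auto simp: shift_space_def PiE_def extensional_def)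
  define L where "L = (LEAST i. x i \<noteq> y i)"
  from False obtain j where j: "x j \<noteq> y j" by blast
  then have L: "x L \<noteq> y L" unfolding L_def by (rule LeastI)
  have below: "x i = y i" if "i < L" for i
    using not_less_Least that unfolding L_def by blast
  have "seq_dist x y < (1/2) ^ n \<longleftrightarrow> n < L"
    using False by (simp add: seq_dist_def L_def[symmetric] power_strict_decreasing_iff
        del: power_divide power_one_over)
  also have "\<dots> \<longleftrightarrow> (\<forall>i\<in>{1..n}. x i = y i)"
  proof
    assume "n < L" then show "\<forall>i\<in>{1..n}. x i = y i" by (intro ballI below) simp
  next
    assume *: "\<forall>i\<in>{1..n}. x i = y i"
    have "L \<noteq> 0" using L x0 by (metis (no_types))
    moreover have "L \<notin> {1..n}" using * L by blast
    ultimately show "n < L" by simp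
  qed
  finally show ?thesis .
qed (simp add: seq_dist_def)

lemma Metric_space_shift_space: "Metric_space (shift_space N) seq_dist"
proof
  fix x y z :: seq
  show "0 \<le> seq_dist x y" by (simp add: seq_dist_def)
  show "seq_dist x y = seq_dist y x" by (auto simp: seq_dist_def eq_commute)
  show "seq_dist x y = 0 \<longleftrightarrow> x = y" by (simp add: seq_dist_def)
  show "seq_dist x z \<le> seq_dist x y + seq_dist y z"
  proof (cases "x = y \<or> y = z \<or> x = z")
    case True then show ?thesis by (auto simp: seq_dist_def)
  next
    case False
    let ?L = "\<lambda>x y :: seq. LEAST i. x i \<noteq> y i"
    from False obtain j where "x j \<noteq> z j" by blast
    then have "x (?L x z) \<noteq> z (?L x z)" by (rule LeastI)
    then have "x (?L x z) \<noteq> y (?L x z) \<or> y (?L x z) \<noteq> z (?L x z)" by auto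
    then have "?L x y \<le> ?L x z \<or> ?L y z \<le> ?L x z" by (auto intro: Least_le)
    then have "(1/2::real) ^ ?L x z \<le> (1/2) ^ ?L x y \<or> (1/2::real) ^ ?L x z \<le> (1/2) ^ ?L y z"
      by (auto intro!: power_decreasing)
    moreover have "(0::real) \<le> (1/2) ^ ?L x y" "(0::real) \<le> (1/2) ^ ?L y z" by auto
    ultimately have "(1/2::real) ^ ?L x z \<le> (1/2) ^ ?L x y + (1/2) ^ ?L y z" by linarith
    then show ?thesis using False by (simp add: seq_dist_def)
  qed
qed

lemma topspace_shift_topology: "topspace (shift_topology N) = shift_space N"
  unfolding shift_topology_def by (rule Metric_space.topspace_mtopology[OF Metric_space_shift_space])

lemma space_bernoulli_measure: "space (bernoulli_measure N) = shift_space N"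
  by (simp add: bernoulli_measure_def shift_space_def space_PiM space_uniform_count_measure)

lemma measure_cylinder:
  assumes "N > 0" "p \<in> shift_space N"
  shows "measure (bernoulli_measure N) (cylinder N m p) = 1 / real N ^ m"
proof -
  let ?M = "\<lambda>_::nat. uniform_count_measure {1..N}"
  interpret product_prob_space ?M "{1..}"
    by (intro product_prob_spaceI prob_space_uniform_count_measure) (use assms in auto)
  have p: "p i \<in> {1..N}" if "i \<in> {1..m}" for i
    using assms that by (auto simp: shift_space_def PiE_def Pi_def)
  have "cylinder N m p = prod_emb {1..} ?M {1..m} (Pi\<^sub>E {1..m} (\<lambda>i. {p i}))"
    by (auto simp: cylinder_def shift_space_def prod_emb_def space_uniform_count_measure
        PiE_iff restrict_def extensional_def)
  moreover have "measure (PiM {1..} ?M) (prod_emb {1..} ?M {1..m} (Pi\<^sub>E {1..m} (\<lambda>i. {p i}))) =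
      (\<Prod>i\<in>{1..m}. measure (uniform_count_measure {1..N}) {p i})"
    by (rule measure_PiM_emb) (use p in \<open>auto simp: sets_uniform_count_measure\<close>)
  ultimately have "measure (bernoulli_measure N) (cylinder N m p) =
      (\<Prod>i\<in>{1..m}. measure (uniform_count_measure {1..N}) {p i})"
    by (simp only: bernoulli_measure_def)
  also have "\<dots> = (\<Prod>i\<in>{1..m}. 1 / real N)"
    by (intro prod.cong refl) (use p in \<open>simp add: measure_uniform_count_measure\<close>)
  finally show ?thesis by (simp add: power_one_over)
qed

lemma prob_space_bernoulli_measure: "N > 0 \<Longrightarrow> prob_space (bernoulli_measure N)"
  unfolding bernoulli_measure_def
  by (intro prob_space_PiM prob_space_uniform_count_measure) auto

lemma dotted_in_shift_space:
  assumes "p \<in> shift_space N" "l \<in> {1..N}"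
  shows "dotted m p l \<in> shift_space N"
  unfolding shift_space_def dotted_def
proof (subst restrict_PiE)
  show "(\<lambda>i. if i \<le> m then p i else l) \<in> {1..} \<rightarrow> {1..N}"
    using assms by (simp add: shift_space_def PiE_iff Pi_iff)
qed

lemma dotted_in_V:
  assumes "p \<in> shift_space N" "l \<in> {1..N}"
  shows "dotted m p l \<in> V N m"
  unfolding V_def
proof (intro CollectI conjI dotted_in_shift_space[OF assms] allI impI)
  fix i assume "m + 1 \<le> i"
  then show "dotted m p l i = dotted m p l (m + 1)" by (simp add: dotted_def)
qed

lemma V_eq_dotted: "V N m = {dotted m p l | p l. p \<in> shift_space N \<and> l \<in> {1..N}}"
proof (intro set_eqI iffI)
  fix x assume "x \<in> V N m"
  then have x: "x \<in> {1..} \<rightarrow>\<^sub>E {1..N}" and const: "\<And>i. i \<ge> m+1 \<Longrightarrow> x i = x (m+1)"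
    unfolding V_def shift_space_def by blast+
  have "x i = dotted m x (x (m+1)) i" for i
  proof -
    consider "i = 0" | "1 \<le> i" "i \<le> m" | "m + 1 \<le> i" by linarith
    then show ?thesis
    proof cases
      case 1
      then show ?thesis using PiE_arb[OF x, of 0] by (simp add: dotted_def)
    next
      case 3
      then show ?thesis using const[OF 3] by (simp add: dotted_def)
    qed (simp add: dotted_def)
  qed
  then have "x = dotted m x (x (m+1))" by (rule ext)
  moreover have "x \<in> shift_space N" "x (m+1) \<in> {1..N}"
    using x PiE_mem[OF x, of "m+1"] by (simp_all add: shift_space_def)
  ultimately show "x \<in> {dotted m p l | p l. p \<in> shift_space N \<and> l \<in> {1..N}}"
    unfolding mem_Collect_eq by (intro exI[of _ x] exI[of _ "x (m+1)"] conjI)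
next
  fix x assume "x \<in> {dotted m p l | p l. p \<in> shift_space N \<and> l \<in> {1..N}}"
  then obtain p l where "x = dotted m p l" "p \<in> shift_space N" "l \<in> {1..N}" by blast
  then show "x \<in> V N m" by (simp only: dotted_in_V)
qed

lemma finite_V: "finite (V N m)"
proof -
  let ?g = "\<lambda>(f::nat \<Rightarrow> nat, l). dotted m f l"
  have "V N m \<subseteq> ?g ` (({1..m} \<rightarrow>\<^sub>E {1..N}) \<times> {1..N})"
  proof
    fix x assume "x \<in> V N m"
    then obtain p l where x: "x = dotted m p l" "p \<in> shift_space N" "l \<in> {1..N}"
      unfolding V_eq_dotted by blast
    have "x = dotted m (restrict p {1..m}) l" unfolding x dotted_def by (auto simp: fun_eq_iff)
    moreover have "restrict p {1..m} \<in> {1..m} \<rightarrow>\<^sub>E {1..N}"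
      using x by (auto simp: shift_space_def PiE_iff)
    ultimately show "x \<in> ?g ` (({1..m} \<rightarrow>\<^sub>E {1..N}) \<times> {1..N})" using x(3) by force
  qed
  then show ?thesis by (rule finite_subset) (intro finite_imageI finite_cartesian_product finite_PiE, auto)
qed

lemma approximating_sequence:
  assumes "N > 1" "x \<in> shift_space N"
  obtains p where "\<And>m. m \<ge> 1 \<Longrightarrow> p m \<in> V N m - V N (m - 1)"
    "limitin (shift_topology N) p x sequentially"
proof
  define p where "p = (\<lambda>m. dotted m x (if x m = 1 then 2 else 1))"
  have sp: "p m \<in> shift_space N" for m
    unfolding p_def using assms by (intro dotted_in_shift_space) auto
  show "p m \<in> V N m - V N (m - 1)" if "m \<ge> 1" for m
  proof -
    have "p m \<in> V N m" unfolding p_def V_eq_dotted using assms by force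
    moreover have "p m (Suc m) \<noteq> p m m" using that by (auto simp: p_def dotted_def)
    then have "p m \<notin> V N (m - 1)"
      using that unfolding V_def by (auto intro!: exI[of _ "Suc m"])
    ultimately show ?thesis by blast
  qed
  interpret Metric_space "shift_space N" seq_dist by (rule Metric_space_shift_space)
  show "limitin (shift_topology N) p x sequentially"
    unfolding shift_topology_def limitin_metric
  proof (intro conjI allI impI)
    fix e :: real assume "e > 0"
    then obtain n where n: "(1/2::real) ^ n < e" using real_arch_pow_inv[of e "1/2"] by auto
    show "\<forall>\<^sub>F m in sequentially. p m \<in> shift_space N \<and> seq_dist (p m) x < e"
      using eventually_ge_at_top[of n]
    proof eventually_elim
      case (elim m)
      then have "seq_dist (p m) x < (1/2) ^ n"
        by (subst seq_dist_less_iff[OF sp assms(2)]) (auto simp: p_def dotted_def)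
      then show ?case using n sp by auto
    qed
  qed (use assms in auto)
qed

lemma has_laplacian_unique:
  assumes "N > 1" "has_laplacian N u f" "has_laplacian N u g" "x \<in> shift_space N"
  shows "f x = g x"
proof -
  obtain p where p: "\<And>m. m \<ge> 1 \<Longrightarrow> p m \<in> V N m - V N (m - 1)"
    "limitin (shift_topology N) p x sequentially"
    using approximating_sequence[OF assms(1,4)] by blast
  let ?q = "\<lambda>m p. H N m u p / measure (bernoulli_measure N) (cylinder N (m+1) p)"
  have *: "(\<lambda>m. ?q m (p m)) \<longlonglongrightarrow> h x" if h: "has_laplacian N u h" for h
  proof -
    let ?M = "\<lambda>m. MAX p\<in>V N m - V N (m - 1). \<bar>?q m p - h p\<bar>"
    have M: "?M \<longlonglongrightarrow> 0" using h by (simp add: has_laplacian_def)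
    have "\<forall>\<^sub>F m in sequentially. norm (?q m (p m) - h (p m)) \<le> ?M m"
      using eventually_ge_at_top[of 1]
    proof eventually_elim
      case (elim m)
      then show ?case using p(1)[OF elim] finite_V[of N m] unfolding real_norm_def
        by (intro Max_ge finite_imageI) auto
    qed
    then have A: "(\<lambda>m. ?q m (p m) - h (p m)) \<longlonglongrightarrow> 0"
      using M by (rule Lim_null_comparison)
    have "limitin euclideanreal (h \<circ> p) (h x) sequentially"
      by (rule continuous_map_limit[OF _ p(2)]) (use h in \<open>simp add: has_laplacian_def\<close>)
    then have "(\<lambda>m. h (p m)) \<longlonglongrightarrow> h x" by (simp add: o_def)
    from tendsto_add[OF A this] show ?thesis by simp
  qed
  show ?thesis using LIMSEQ_unique[OF *[OF assms(2)] *[OF assms(3)]] .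
qed

end

theory Submission
  imports Defs
begin

text \<open>
  \<open>y = phi_minus N x\<close> is the root below 1 of \<open>y (N - y) = x (1 - y)\<close>, which is exactly the relation
  making the prolongation by \<open>1 / (1 - y)\<close> carry the eigenvalue equation for \<open>x\<close> on one level to
  that for \<open>y\<close> on the next. A maximum principle gives \<open>lam m0 \<ge> 0\<close>; then \<open>N * phi_minus N x \<le> x\<close>
  shows that \<open>N ^ (m + 1) * lam m\<close> decreases, hence converges, and that \<open>lam\<close> is summable.
  Precomposing \<open>um m\<close> with the truncation \<open>x \<mapsto> (x\<^sub>1 \<dots> x\<^sub>m x\<^sub>m\<^sub>+\<^sub>1 x\<^sub>m\<^sub>+\<^sub>1 \<dots>)\<close> gives locally constant
  functions whose successive relative increments are at most \<open>lam m\<close>. They therefore converge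
  uniformly to a continuous function, which is the extension \<open>u\<close>, and on the new vertices of level
  \<open>m\<close> the Laplacian quotient is \<open>- N ^ (m + 1) * lam m * u\<close>.
\<close>

section \<open>Vertex sets and dotted sequences\<close>

lemma dotted_cong: "(\<And>i. 1 \<le> i \<Longrightarrow> i \<le> m \<Longrightarrow> p i = q i) \<Longrightarrow> dotted m p l = dotted m q l"
  by (auto simp: dotted_def fun_eq_iff)

lemma shift_spaceD: "x \<in> shift_space N \<Longrightarrow> 1 \<le> i \<Longrightarrow> x i \<in> {1..N}"
  by (auto simp: shift_space_def PiE_iff)

lemma V_subset: "V N m \<subseteq> shift_space N"
  by (auto simp: V_def)

lemma V_const: "x \<in> V N m \<Longrightarrow> i \<ge> m + 1 \<Longrightarrow> x i = x (m + 1)"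
  unfolding V_def by blast

lemma V_mono:
  assumes "m \<le> n"
  shows "V N m \<subseteq> V N n"
proof
  fix x assume x: "x \<in> V N m"
  have "x i = x (n + 1)" if "i \<ge> n + 1" for i
    using V_const[OF x, of i] V_const[OF x, of "n + 1"] that assms by linarith
  moreover have "x \<in> shift_space N" using x V_subset by blast
  ultimately show "x \<in> V N n" unfolding V_def by blast
qed

lemma dotted_V_eq: "p \<in> V N m \<Longrightarrow> dotted m p (p (m + 1)) = p"
proof
  fix i assume p: "p \<in> V N m"
  then have s: "p \<in> {1..} \<rightarrow>\<^sub>E {1..N}"
    unfolding V_def shift_space_def by blast
  show "dotted m p (p (m + 1)) i = p i"
    using V_const[OF p, of i] PiE_arb[OF s, of i] by (auto simp: dotted_def restrict_def)
qed

lemma inj_dotted: "inj (dotted m p)"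
proof
  fix k l assume "dotted m p k = dotted m p l"
  then have "dotted m p k (m + 1) = dotted m p l (m + 1)" by simp
  then show "k = l" by (simp add: dotted_def)
qed

lemma nbrs_subset: "p \<in> V N m \<Longrightarrow> nbrs N p m \<subseteq> V N m"
  using V_subset dotted_in_V by (fastforce simp: nbrs_def)

section \<open>Difference operators as sums of differences, and a maximum principle\<close>

lemma local_difference:
  assumes "p \<in> V N m"
  shows "- (real N - 1) * u p + (\<Sum>q\<in>nbrs N p m. u q) = (\<Sum>l=1..N. u (dotted m p l) - u p)"
proof -
  let ?A = "dotted m p ` {1..N}"
  have "p (m + 1) \<in> {1..N}" using assms V_subset shift_spaceD by (meson le_add2 subsetD)
  \<comment> \<open>The symbol \<open>p (m + 1)\<close> gives back \<open>p\<close> itself, so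
    summing differences over all symbols, instead of over \<open>nbrs\<close>, only adds a zero
    term.\<close>
  then have p: "p \<in> ?A" using dotted_V_eq[OF assms] by (metis imageI)
  have "nbrs N p m = ?A - {p}" by (auto simp: nbrs_def)
  then have "(\<Sum>q\<in>nbrs N p m. u q) = (\<Sum>q\<in>?A. u q) - u p"
    using p by (simp add: sum_diff1)
  also have "(\<Sum>q\<in>?A. u q) = (\<Sum>l=1..N. u (dotted m p l))"
    using inj_dotted by (subst sum.reindex) (auto intro: inj_on_subset)
  finally show ?thesis by (simp add: sum_subtractf algebra_simps)
qed

lemma H_0_diff:
  "p \<in> V N 0 \<Longrightarrow> H N 0 u p = (\<Sum>l=1..N. u (dotted 0 p l) - u p)"
  using local_difference[of p N 0 u] by simp

lemma H_Suc_diff: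
  assumes "p \<in> V N (Suc m)"
  shows "H N (Suc m) u p =
    (if p \<in> V N m then H N m u p else 0) + (\<Sum>l=1..N. u (dotted (Suc m) p l) - u p)"
  using local_difference[OF assms, of u] by (simp only: H.simps split: if_split) linarith

lemma H_cong:
  assumes "\<And>q. q \<in> V N m \<Longrightarrow> u q = v q" "p \<in> V N m"
  shows "H N m u p = H N m v p"
  using assms
proof (induction m)
  case 0
  then have "(\<Sum>q\<in>nbrs N p 0. u q) = (\<Sum>q\<in>nbrs N p 0. v q)"
    using nbrs_subset by (intro sum.cong) blast+
  with 0 show ?case by simp
next
  case (Suc m)
  have "(\<Sum>q\<in>nbrs N p (Suc m). u q) = (\<Sum>q\<in>nbrs N p (Suc m). v q)"
    using Suc.prems nbrs_subset by (intro sum.cong) blast+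
  moreover have "p \<in> V N m \<Longrightarrow> H N m u p = H N m v p"
    using Suc.IH Suc.prems V_mono[of m "Suc m" N] by auto
  ultimately show ?case using Suc.prems by simp
qed

text \<open>Where the absolute value is maximal, every difference to another vertex is zero or has
  the sign opposite to \<open>u p\<close>. Multiplying by \<open>u p\<close> treats positive maxima
  and negative minima together, and the levels making up \<open>H\<close> are summed by
  induction.\<close>

lemma H_at_abs_max:
  assumes "p \<in> V N m" "\<And>q. q \<in> V N m \<Longrightarrow> \<bar>u q\<bar> \<le> \<bar>u p\<bar>"
  shows "u p * H N m u p \<le> 0"
  using assms
proof (induction m)
  have *: "u p * (\<Sum>l=1..N. u (dotted m p l) - u p) \<le> 0"
    if p: "p \<in> V N m" and max: "\<And>q. q \<in> V N m \<Longrightarrow> \<bar>u q\<bar> \<le> \<bar>u p\<bar>" for m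
  proof -
    have "u p * (u (dotted m p l) - u p) \<le> 0" if "l \<in> {1..N}" for l
    proof -
      have "\<bar>u (dotted m p l)\<bar> \<le> \<bar>u p\<bar>"
        using that p V_subset by (intro max dotted_in_V) auto
      then have "\<bar>u p\<bar> * \<bar>u (dotted m p l)\<bar> \<le> \<bar>u p\<bar> * \<bar>u p\<bar>"
        by (rule mult_left_mono) simp
      then have "u p * u (dotted m p l) \<le> u p * u p"
        using abs_ge_self[of "u p * u (dotted m p l)"] by (simp add: abs_mult)
      then show ?thesis by (simp add: algebra_simps)
    qed
    then show ?thesis unfolding sum_distrib_left by (rule sum_nonpos)
  qed
  {
    case 0
    then show ?case using *[of 0] by (simp only: H_0_diff)
  next
    case (Suc m)
    have "p \<in> V N m \<Longrightarrow> u p * H N m u p \<le> 0"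
      using Suc.IH Suc.prems V_mono[of m "Suc m" N] by auto
    then have "u p * (if p \<in> V N m then H N m u p else 0) \<le> 0" by simp
    then show ?case
      using *[OF Suc.prems] by (simp only: H_Suc_diff[OF Suc.prems(1)] distrib_left) simp
  }
qed

lemma H_dirichlet_eigenvalue_nonneg:
  assumes "H_dirichlet_eigenpair N m lam u"
  shows "lam \<ge> 0"
proof -
  obtain q where q: "q \<in> V N m" "u q \<noteq> 0"
    using assms by (auto simp: H_dirichlet_eigenpair_def)
  have "Max ((\<lambda>p. \<bar>u p\<bar>) ` V N m) \<in> (\<lambda>p. \<bar>u p\<bar>) ` V N m"
    using q finite_V by (intro Max_in) auto
  then obtain p where p: "p \<in> V N m" "\<bar>u p\<bar> = Max ((\<lambda>p. \<bar>u p\<bar>) ` V N m)" by auto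
  have max: "\<bar>u q\<bar> \<le> \<bar>u p\<bar>" if "q \<in> V N m" for q
    unfolding p(2) using finite_V that by (intro Max_ge) auto
  \<comment> \<open>A maximum of the absolute value that is nonzero cannot sit on the boundary, so
    the eigenvalue equation is available at \<open>p\<close>.\<close>
  have "u p \<noteq> 0" using max[OF q(1)] q(2) by auto
  then have "p \<in> V N m - V N 0" using assms p(1) by (auto simp: H_dirichlet_eigenpair_def)
  then have "H N m u p = - lam * u p" using assms by (simp add: H_dirichlet_eigenpair_def)
  then have "0 \<le> lam * (u p)\<^sup>2"
    using H_at_abs_max[of p N m u] p(1) max by (simp add: algebra_simps power2_eq_square)
  moreover have "0 < (u p)\<^sup>2" using \<open>u p \<noteq> 0\<close> by simp
  ultimately show ?thesis by (simp add: zero_le_mult_iff)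
qed

section \<open>The quadratic relation behind \<open>phi_minus\<close>\<close>

context
  fixes N :: nat
  assumes N: "N > 1"
begin

text \<open>The discriminant is \<open>(N + x - 2)^2 + 4 (N - 1)\<close>, so its root exceeds
  \<open>|N + x - 2|\<close> for every real \<open>x\<close>.\<close>

lemma phi_minus_less_1: "phi_minus N x < 1"
proof -
  have "\<bar>real N + x - 2\<bar> < sqrt ((real N + x)\<^sup>2 - 4 * x)"
    using N by (intro real_less_rsqrt) (simp add: power2_eq_square algebra_simps)
  then show ?thesis by (simp add: phi_minus_def)
qed

lemma phi_minus_root: "phi_minus N x * (real N - phi_minus N x) = x * (1 - phi_minus N x)"
proof -
  define s where "s = sqrt ((real N + x)\<^sup>2 - 4 * x)"
  have "0 \<le> (real N + x - 2)\<^sup>2 + 4 * (real N - 1)" using N by (intro add_nonneg_nonneg) auto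
  also have "\<dots> = (real N + x)\<^sup>2 - 4 * x" by (simp add: power2_eq_square algebra_simps)
  finally have "s * s = (real N + x)\<^sup>2 - 4 * x" by (simp add: s_def)
  moreover have "s = real N + x - 2 * phi_minus N x" by (simp add: phi_minus_def s_def field_simps)
  ultimately show ?thesis by (simp add: power2_eq_square algebra_simps)
qed

lemma phi_minus_nonneg: "x \<ge> 0 \<Longrightarrow> phi_minus N x \<ge> 0"
  by (auto simp: phi_minus_def intro!: real_le_lsqrt)

text \<open>With \<open>y = phi_minus N x\<close>, this bounds the relative increment
  \<open>y / (1 - y)\<close> of one prolongation step by \<open>x\<close>. It holds because
  \<open>N - y >= 1\<close> in the quadratic relation.\<close>

lemma phi_minus_le: "x \<ge> 0 \<Longrightarrow> phi_minus N x \<le> x * (1 - phi_minus N x)"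
proof -
  assume "x \<ge> 0"
  then have "phi_minus N x * 1 \<le> phi_minus N x * (real N - phi_minus N x)"
    using N phi_minus_less_1[of x] \<open>x \<ge> 0\<close> by (intro mult_left_mono phi_minus_nonneg) auto
  then show ?thesis by (simp add: phi_minus_root)
qed

text \<open>The quadratic relation says \<open>x - N y = y (x - y)\<close> for
  \<open>y = phi_minus N x\<close>, and \<open>0 <= y <= x\<close>.\<close>

lemma phi_minus_contracts: "x \<ge> 0 \<Longrightarrow> real N * phi_minus N x \<le> x"
proof -
  assume x: "x \<ge> 0"
  have "x - real N * phi_minus N x = phi_minus N x * (x - phi_minus N x)"
    using phi_minus_root[of x] by (simp add: algebra_simps)
  moreover have "phi_minus N x \<le> x * 1"
    using phi_minus_le[OF x] mult_left_mono[of "1 - phi_minus N x" 1 x] x phi_minus_nonneg[OF x]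
    by linarith
  then have "0 \<le> phi_minus N x * (x - phi_minus N x)"
    using phi_minus_nonneg[OF x] by (intro mult_nonneg_nonneg) auto
  ultimately show ?thesis by linarith
qed

end

section \<open>Uniform limits and continuity on the shift space\<close>

lemma uniform_limit_of_summable_relative_increments:
  fixes w :: "nat \<Rightarrow> 'a \<Rightarrow> real"
  assumes a: "summable a" "\<And>n. a n \<ge> 0"
    and inc: "\<And>n x. x \<in> S \<Longrightarrow> \<bar>w (Suc n) x - w n x\<bar> \<le> a n * \<bar>w n x\<bar>"
    and w0: "\<And>x. x \<in> S \<Longrightarrow> \<bar>w 0 x\<bar> \<le> B"
  obtains v where "uniform_limit S w v sequentially"
proof -
  \<comment> \<open>Each step multiplies the size by at most \<open>1 + a n <= exp (a n)\<close>.
    Summability of \<open>a\<close> then makes the sizes uniformly bounded, so the relative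
    increments become absolute ones suited to the Weierstrass test.\<close>
  have bnd: "\<bar>w n x\<bar> \<le> B * exp (\<Sum>i<n. a i)" if x: "x \<in> S" for n x
  proof (induction n)
    case (Suc n)
    have "\<bar>w (Suc n) x\<bar> \<le> \<bar>w n x\<bar> * (1 + a n)" using inc[OF x, of n] by (simp add: algebra_simps)
    also have "\<dots> \<le> (B * exp (\<Sum>i<n. a i)) * exp (a n)"
      using Suc a(2)[of n] by (intro mult_mono exp_ge_add_one_self) auto
    finally show ?case by (simp add: exp_add mult_ac)
  qed (use w0 x in simp)
  \<comment> \<open>The absolute value of \<open>B\<close> covers the case of empty
    \<open>S\<close>, where \<open>B\<close> may be negative.\<close>
  have "B * exp (\<Sum>i<n. a i) \<le> \<bar>B\<bar> * exp (suminf a)" for n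
    using sum_le_suminf[OF a(1), of "{..<n}"] a(2) by (intro mult_mono) auto
  with bnd have C: "\<bar>w n x\<bar> \<le> \<bar>B\<bar> * exp (suminf a)" if "x \<in> S" for n x
    using that by (meson order_trans)
  have "uniform_limit S (\<lambda>n x. \<Sum>i<n. w (Suc i) x - w i x)
      (\<lambda>x. \<Sum>i. w (Suc i) x - w i x) sequentially"
  proof (rule Weierstrass_m_test)
    fix n x assume "x \<in> S"
    then show "norm (w (Suc n) x - w n x) \<le> a n * (\<bar>B\<bar> * exp (suminf a))"
      using inc[of x n] mult_left_mono[OF C[of x n] a(2)[of n]] by simp
  qed (use a in \<open>intro summable_mult2\<close>)
  moreover have "(\<Sum>i<n. w (Suc i) x - w i x) = w n x - w 0 x" for n x
    by (rule sum_lessThan_telescope)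
  ultimately have "uniform_limit S (\<lambda>n x. w n x - w 0 x)
      (\<lambda>x. \<Sum>i. w (Suc i) x - w i x) sequentially" by simp
  from uniform_limit_add[OF this uniform_limit_const, of "w 0"] show ?thesis
    by (intro that) simp
qed


text \<open>A function of the first \<open>n\<close> symbols is constant on every ball of radius
  \<open>(1/2)^n\<close>.\<close>

lemma continuous_map_finitely_determined:
  fixes f :: "seq \<Rightarrow> real"
  assumes "\<And>x y. x \<in> shift_space N \<Longrightarrow> y \<in> shift_space N \<Longrightarrow>
    (\<And>i. i \<in> {1..n} \<Longrightarrow> x i = y i) \<Longrightarrow> f x = f y"
  shows "continuous_map (shift_topology N) euclideanreal f"
  unfolding shift_topology_def Metric_space.continuous_map_from_metric[OF Metric_space_shift_space]
proof (intro conjI ballI allI impI)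
  fix x U assume x: "x \<in> shift_space N" and U: "openin euclideanreal U \<and> f x \<in> U"
  have "f y \<in> U" if "y \<in> shift_space N \<and> seq_dist x y < (1/2) ^ n" for y
    using assms[of x y] x that U seq_dist_less_iff[of x N y n] by simp
  then show "\<exists>r>0. \<forall>y. y \<in> shift_space N \<and> seq_dist x y < r \<longrightarrow> f y \<in> U"
    by (intro exI[of _ "(1/2) ^ n"]) auto
qed auto

text \<open>Boundedness is read off from one close approximant rather than from compactness; it
  later controls the error in the Laplacian uniformly.\<close>

lemma continuous_map_shift_bounded:
  fixes f :: "seq \<Rightarrow> real"
  assumes "\<And>m. continuous_map (shift_topology N) euclideanreal (w m)"
    "\<And>m. \<exists>B. \<forall>x\<in>shift_space N. \<bar>w m x\<bar> \<le> B"
    "uniform_limit (shift_space N) w f sequentially"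
  shows "continuous_map (shift_topology N) euclideanreal f"
    "\<exists>B. \<forall>x\<in>shift_space N. \<bar>f x\<bar> \<le> B"
proof -
  have near: "\<forall>\<^sub>F m in sequentially. \<forall>x\<in>shift_space N. dist (w m x) (f x) < e" if "e > 0" for e
    using assms(3) that by (rule uniform_limitD)
  have "continuous_map (shift_topology N) Met_TC.mtopology f"
    by (rule Met_TC.continuous_map_uniform_limit[where f = w and F = sequentially])
      (use assms(1) near in \<open>auto simp: topspace_shift_topology\<close>)
  then show "continuous_map (shift_topology N) euclideanreal f" by simp
  obtain m where m: "\<And>x. x \<in> shift_space N \<Longrightarrow> dist (w m x) (f x) < 1"
    using near[of 1] unfolding eventually_sequentially by fastforce
  obtain B where "\<And>x. x \<in> shift_space N \<Longrightarrow> \<bar>w m x\<bar> \<le> B" using assms(2) by blast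
  then have "\<bar>f x\<bar> \<le> B + 1" if "x \<in> shift_space N" for x
    using m[OF that] that unfolding dist_real_def by fastforce
  then show "\<exists>B. \<forall>x\<in>shift_space N. \<bar>f x\<bar> \<le> B" by blast
qed

section \<open>Spectral decimation of the eigenfunctions\<close>

locale spectral_decimation =
  fixes N m0 :: nat and lam :: "nat \<Rightarrow> real" and um :: "nat \<Rightarrow> seq \<Rightarrow> real"
  assumes N: "N > 1" and m0: "m0 \<ge> 1"
    and eigenpair: "H_dirichlet_eigenpair N m0 (lam m0) (um m0)"
    and lam_Suc: "m \<ge> m0 \<Longrightarrow> lam (Suc m) = phi_minus N (lam m)"
    and um_old: "m \<ge> m0 \<Longrightarrow> p \<in> V N m \<Longrightarrow> um (Suc m) p = um m p"
    and um_new: "m \<ge> m0 \<Longrightarrow> p \<in> V N (Suc m) - V N m \<Longrightarrow>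
      um (Suc m) p = um m (parent (Suc m) p) / (1 - lam (Suc m))"
    and um_below: "m < m0 \<Longrightarrow> p \<in> V N m \<Longrightarrow> um m p = um m0 p"
begin

lemma lam_nonneg: "m \<ge> m0 \<Longrightarrow> lam m \<ge> 0"
proof (induction m rule: dec_induct)
  case base
  show ?case by (rule H_dirichlet_eigenvalue_nonneg[OF eigenpair])
next
  case (step m)
  then show ?case by (simp add: lam_Suc phi_minus_nonneg[OF N])
qed

text \<open>This keeps the denominators \<open>1 - lam (Suc m)\<close> positive. The starting value
  \<open>lam m0\<close> itself need not lie below 1.\<close>

lemma lam_Suc_less_1: "m \<ge> m0 \<Longrightarrow> lam (Suc m) < 1"
  by (simp add: lam_Suc phi_minus_less_1[OF N])

text \<open>The rule for new vertices read from parent to child: the sequences here are the new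
  vertices whose parent is \<open>p\<close>.\<close>

lemma um_new_eq:
  assumes "m \<ge> m0" "p \<in> V N m" "l \<in> {1..N}" "l \<noteq> p (Suc m)"
  shows "um (Suc m) (dotted (Suc m) p l) = um m p / (1 - lam (Suc m))"
proof -
  let ?q = "dotted (Suc m) p l"
  have q: "?q (Suc m) = p (Suc m)" "?q (Suc (Suc m)) = l" by (simp_all add: dotted_def)
  have "?q \<in> V N (Suc m)" using assms V_subset by (intro dotted_in_V) auto
  moreover have "?q \<notin> V N m"
  proof
    assume "?q \<in> V N m"
    from V_const[OF this, of "Suc (Suc m)"] q assms(4) show False by simp
  qed
  moreover have "parent (Suc m) ?q = dotted m p (p (m + 1))"
    unfolding parent_def q by (simp add: dotted_def fun_eq_iff)
  ultimately show ?thesis using um_new[OF assms(1)] dotted_V_eq[OF assms(2)] by simp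
qed

text \<open>Let \<open>y = lam (Suc m)\<close>. At an old vertex the \<open>N - 1\<close> new
  neighbours share the value \<open>um m p / (1 - y)\<close>, and the equation becomes
  \<open>lam m (1 - y) = y (N - y)\<close>. At a new vertex only the edge to the parent contributes,
  so nothing is needed from level \<open>m\<close>.\<close>

lemma spectral_decimation_step:
  assumes m: "m \<ge> m0" and p: "p \<in> V N (Suc m) - V N 0"
    and IH: "p \<in> V N m \<Longrightarrow> H N m (um m) p = - lam m * um m p"
  shows "H N (Suc m) (um (Suc m)) p = - lam (Suc m) * um (Suc m) p"
proof (cases "p \<in> V N m")
  case True
  let ?y = "lam (Suc m)"
  have y: "?y < 1" using lam_Suc_less_1[OF m] .
  have ps: "p (Suc m) \<in> {1..N}" using shift_spaceD[of p N "Suc m"] V_subset True by auto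
  have old: "H N m (um (Suc m)) p = - lam m * um m p"
    using H_cong[of N m "um (Suc m)" "um m" p] um_old[OF m] True IH by simp
  have "(\<Sum>l=1..N. um (Suc m) (dotted (Suc m) p l) - um (Suc m) p) =
    (\<Sum>l\<in>{1..N} - {p (Suc m)}. um (Suc m) (dotted (Suc m) p l) - um (Suc m) p)"
  proof (rule sum.mono_neutral_right)
    \<comment> \<open>As an old vertex, \<open>p\<close> is already constant from position
      \<open>Suc m\<close> on.\<close>
    have "dotted (Suc m) p (p (Suc m)) = p"
      using dotted_V_eq[of p N "Suc m"] p V_const[OF True, of "Suc (Suc m)"] by simp
    then show "\<forall>l\<in>{1..N} - ({1..N} - {p (Suc m)}). um (Suc m) (dotted (Suc m) p l) - um (Suc m) p = 0"
      by auto
  qed auto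
  also have "\<dots> = (\<Sum>l\<in>{1..N} - {p (Suc m)}. um m p / (1 - ?y) - um m p)"
    using um_new_eq[OF m True] um_old[OF m True] by (intro sum.cong) auto
  also have "\<dots> = (real N - 1) * (um m p / (1 - ?y) - um m p)"
    using N ps by (simp add: of_nat_diff)
  finally have "(\<Sum>l=1..N. um (Suc m) (dotted (Suc m) p l) - um (Suc m) p) =
    (real N - 1) * (um m p / (1 - ?y) - um m p)" .
  moreover have "lam m = ?y * (real N - ?y) / (1 - ?y)"
    using phi_minus_root[OF N, of "lam m"] y by (simp add: lam_Suc[OF m] field_simps)
  ultimately have "H N (Suc m) (um (Suc m)) p =
      - (?y * (real N - ?y) / (1 - ?y)) * um m p + (real N - 1) * (um m p / (1 - ?y) - um m p)"
    using p True old H_Suc_diff[of p N m "um (Suc m)"] by auto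
  also have "\<dots> = - ?y * um m p" using y by (simp add: divide_simps) (simp add: algebra_simps)
  finally show ?thesis using um_old[OF m True] by simp
next
  case False
  let ?v = "um (Suc m)" and ?y = "lam (Suc m)"
  \<comment> \<open>All neighbours of \<open>p\<close> other than its parent \<open>b\<close> have that same parent, hence the same value as \<open>p\<close>.\<close>
  define b where "b = parent (Suc m) p"
  have p': "p \<in> V N (Suc m) - V N m" using p False by auto
  then have ps: "p \<in> shift_space N" using V_subset by auto
  have y: "?y < 1" using lam_Suc_less_1[OF m] .
  have b: "b \<in> V N m" "b (Suc m) = p (Suc m)"
    unfolding b_def parent_def using shift_spaceD[OF ps] dotted_in_V[OF ps, of "p (Suc m)" m]
    by (auto simp: dotted_def)
  have db: "dotted (Suc m) p l = dotted (Suc m) b l" for l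
    by (rule dotted_cong) (auto simp: b_def parent_def dotted_def le_Suc_eq)
  have vp: "?v p = um m b / (1 - ?y)" using um_new[OF m p'] by (simp add: b_def)
  have "?v (dotted (Suc m) p l) - ?v p = 0" if "l \<in> {1..N} - {p (Suc m)}" for l
    using um_new_eq[OF m b(1), of l] that b(2) vp by (simp add: db)
  moreover have "p (Suc m) \<in> {1..N}" using shift_spaceD[OF ps] by simp
  ultimately have "(\<Sum>l=1..N. ?v (dotted (Suc m) p l) - ?v p) = ?v (dotted (Suc m) p (p (Suc m))) - ?v p"
    by (subst sum.remove[of _ "p (Suc m)"]) auto
  also have "dotted (Suc m) p (p (Suc m)) = dotted m p (p (Suc m))"
    by (auto simp: dotted_def fun_eq_iff le_Suc_eq)
  also have "\<dots> = b" by (simp add: b_def parent_def)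
  also have "?v b = um m b" using um_old[OF m b(1)] .
  finally have "H N (Suc m) ?v p = um m b - ?v p"
    using H_Suc_diff[of p N m ?v] p' by simp
  also have "\<dots> = - ?y * ?v p" using y vp by (simp add: field_simps)
  finally show ?thesis .
qed

lemma H_um:
  assumes "m \<ge> m0" "p \<in> V N m - V N 0"
  shows "H N m (um m) p = - lam m * um m p"
  using assms
proof (induction m arbitrary: p rule: dec_induct)
  case base
  then show ?case using eigenpair by (simp add: H_dirichlet_eigenpair_def)
next
  case (step m)
  then show ?case by (intro spectral_decimation_step) auto
qed

section \<open>Decay of the eigenvalues\<close>

lemma renormalized_lam_convergent: "convergent (\<lambda>m. real N ^ (m + 1) * lam m)"
proof -
  let ?e = "\<lambda>m. real N ^ (m + 1) * lam m"
  \<comment> \<open>The index is shifted because \<open>lam\<close> is arbitrary below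
    \<open>m0\<close>.\<close>
  have "decseq (\<lambda>n. ?e (n + m0))"
  proof (rule decseq_SucI)
    fix n
    have "real N ^ (n + m0 + 1) * (real N * lam (Suc (n + m0))) \<le> real N ^ (n + m0 + 1) * lam (n + m0)"
      using phi_minus_contracts[OF N lam_nonneg[of "n + m0"]] by (intro mult_left_mono) (auto simp: lam_Suc)
    then show "?e (Suc n + m0) \<le> ?e (n + m0)" by (simp add: mult_ac)
  qed
  moreover have "0 \<le> ?e (n + m0)" for n using lam_nonneg[of "n + m0"] by simp
  ultimately have "convergent (\<lambda>n. ?e (n + m0))"
    using decseq_convergent[of "\<lambda>n. ?e (n + m0)" 0] by (metis (no_types, lifting) convergent_def)
  then obtain L where "(\<lambda>n. ?e (n + m0)) \<longlonglongrightarrow> L" by (auto simp: convergent_def)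
  then have "?e \<longlonglongrightarrow> L" by (rule LIMSEQ_offset)
  then show ?thesis by (auto simp: convergent_def)
qed

lemma summable_lam: "summable (\<lambda>n. lam (n + m0))"
proof (rule summable_ratio_test)
  show "1 / real N < 1" using N by simp
  show "norm (lam (Suc n + m0)) \<le> 1 / real N * norm (lam (n + m0))" if "n \<ge> 0" for n
    using phi_minus_contracts[OF N lam_nonneg[of "n + m0"]] N lam_nonneg[of "n + m0"]
      lam_nonneg[of "Suc (n + m0)"] by (simp add: lam_Suc field_simps)
qed

section \<open>Uniform convergence of the prolongations\<close>

lemma bounded_um: "\<exists>B. \<forall>p\<in>V N m. \<bar>um k p\<bar> \<le> B"
  using finite_V[of N m] by (intro exI[of _ "Max ((\<lambda>p. \<bar>um k p\<bar>) ` V N m)"]) auto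

lemma um_stable: "k \<ge> m0 \<Longrightarrow> p \<in> V N k \<Longrightarrow> k \<le> m \<Longrightarrow> um m p = um k p"
proof (rotate_tac 2, induction m rule: dec_induct)
  case (step m)
  then have "p \<in> V N m" using V_mono by blast
  with step show ?case by (simp add: um_old)
qed simp

text \<open>The locally constant function obtained from level \<open>n + m0\<close> by truncation;
  the shift makes index 0 the given eigenfunction.\<close>

definition prolongation :: "nat \<Rightarrow> seq \<Rightarrow> real" where
  "prolongation n x = um (n + m0) (dotted (n + m0) x (x (n + m0 + 1)))"

lemma prolongation_vertex:
  assumes "x \<in> shift_space N"
  shows "dotted m x (x (m + 1)) \<in> V N m"
  using assms shift_spaceD[OF assms, of "m + 1"] by (intro dotted_in_V) auto

lemma prolongation_continuous: "continuous_map (shift_topology N) euclideanreal (prolongation n)"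
proof (rule continuous_map_finitely_determined[of N "n + m0 + 1"])
  fix x y :: seq assume eq: "\<And>i. i \<in> {1..n + m0 + 1} \<Longrightarrow> x i = y i"
  then have "dotted (n + m0) x l = dotted (n + m0) y l" for l by (intro dotted_cong) auto
  then show "prolongation n x = prolongation n y"
    using eq[of "n + m0 + 1"] by (simp add: prolongation_def)
qed

lemma prolongation_bounded: "\<exists>B. \<forall>x\<in>shift_space N. \<bar>prolongation n x\<bar> \<le> B"
  using bounded_um[of "n + m0" "n + m0"] prolongation_vertex unfolding prolongation_def by blast

text \<open>If the next symbol repeats the last one, the truncation does not change. Otherwise it
  moves to a child, which scales the value by \<open>1 / (1 - y)\<close> with
  \<open>y = lam (Suc k)\<close>.\<close>

lemma prolongation_increment:
  assumes "x \<in> shift_space N"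
  shows "\<bar>prolongation (Suc n) x - prolongation n x\<bar> \<le> lam (n + m0) * \<bar>prolongation n x\<bar>"
proof -
  define k where "k = n + m0"
  have k: "k \<ge> m0" by (simp add: k_def)
  define b where "b = dotted k x (x (Suc k))"
  let ?l = "x (Suc (Suc k))" and ?y = "lam (Suc k)"
  have b: "b \<in> V N k" "b (Suc k) = x (Suc k)"
    using prolongation_vertex[OF assms, of k] by (simp_all add: b_def dotted_def)
  have l: "?l \<in> {1..N}" using shift_spaceD[OF assms] by simp
  have old: "prolongation n x = um k b" by (simp add: prolongation_def k_def b_def)
  have "dotted (Suc k) x ?l = dotted (Suc k) b ?l"
    by (rule dotted_cong) (auto simp: b_def dotted_def le_Suc_eq)
  then have new: "prolongation (Suc n) x = um (Suc k) (dotted (Suc k) b ?l)"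
    by (simp add: prolongation_def k_def)
  show ?thesis
  proof (cases "?l = x (Suc k)")
    case True
    have "b \<in> V N (Suc k)" using b(1) V_mono[of k "Suc k"] by auto
    then have "dotted (Suc k) b ?l = b"
      using dotted_V_eq[of b N "Suc k"] V_const[OF b(1), of "Suc (Suc k)"] b(2) True by simp
    then show ?thesis using old new um_old[OF k b(1)] lam_nonneg[OF k] by (simp add: k_def)
  next
    case False
    have y: "0 \<le> ?y" "?y < 1" "?y \<le> lam k * (1 - ?y)"
      using lam_nonneg[of "Suc k"] lam_Suc_less_1[OF k] phi_minus_le[OF N lam_nonneg[OF k]] k
      by (simp_all add: lam_Suc[OF k])
    have "prolongation (Suc n) x = um k b / (1 - ?y)"
      using um_new_eq[OF k b(1) l] False b(2) new by simp
    then have "prolongation (Suc n) x - prolongation n x = ?y / (1 - ?y) * um k b"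
      using old y(2) by (simp add: field_simps)
    then have "\<bar>prolongation (Suc n) x - prolongation n x\<bar> = ?y / (1 - ?y) * \<bar>um k b\<bar>"
      using y by (simp add: abs_mult)
    also have "\<dots> \<le> lam k * \<bar>um k b\<bar>"
      using y by (intro mult_right_mono) (simp_all add: field_simps)
    finally show ?thesis by (simp add: old k_def)
  qed
qed

text \<open>At a vertex of level \<open>m >= m0\<close> the prolongations are constant from index
  \<open>m\<close> on, so the limit interpolates all \<open>um\<close>; lower levels reduce to
  \<open>m0\<close>.\<close>

lemma limit_function:
  obtains v where "continuous_map (shift_topology N) euclideanreal v"
    "\<exists>B. \<forall>x\<in>shift_space N. \<bar>v x\<bar> \<le> B"
    "\<And>m x. x \<in> V N m \<Longrightarrow> v x = um m x"
proof -
  obtain B where B: "\<And>x. x \<in> shift_space N \<Longrightarrow> \<bar>prolongation 0 x\<bar> \<le> B"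
    using prolongation_bounded by blast
  have "lam (n + m0) \<ge> 0" for n by (simp add: lam_nonneg)
  from uniform_limit_of_summable_relative_increments[where w = prolongation,
      OF summable_lam this prolongation_increment B]
  obtain v where v: "uniform_limit (shift_space N) prolongation v sequentially"
    by blast
  have late: "v x = um m x" if "m \<ge> m0" and x: "x \<in> V N m" for m x
  proof -
    have xs: "x \<in> shift_space N" using x V_subset by auto
    have "prolongation n x = um m x" if "n \<ge> m" for n
    proof -
      have "x \<in> V N (n + m0)" using V_mono[of m "n + m0" N] x that by auto
      then show ?thesis
        using um_stable[OF \<open>m \<ge> m0\<close> x, of "n + m0"] that
        unfolding prolongation_def by (simp only: dotted_V_eq)
    qed
    then have "(\<lambda>n. prolongation n x) \<longlonglongrightarrow> um m x"
      by (intro tendsto_eventually eventually_sequentiallyI)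
    with tendsto_uniform_limitI[OF v xs] show ?thesis by (rule LIMSEQ_unique)
  qed
  have "v x = um m x" if "x \<in> V N m" for m x
  proof (cases "m \<ge> m0")
    case False
    then show ?thesis using late[of m0 x] um_below[of m x] V_mono[of m m0 N] that by auto
  qed (use late that in blast)
  with continuous_map_shift_bounded[OF prolongation_continuous prolongation_bounded v] show ?thesis
    by (rule that)
qed

section \<open>The extension and its Laplacian\<close>

lemma extension_eq:
  assumes v: "continuous_map (shift_topology N) euclideanreal v"
    and v_um: "\<And>m x. x \<in> V N m \<Longrightarrow> v x = um m x"
    and x: "x \<in> shift_space N"
  shows "extension N um x = v x"
proof (cases "x \<in> V_star N")
  case True
  then have "x \<in> V N (LEAST i. x \<in> V N i)" unfolding V_star_def by (metis LeastI UN_E)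
  then show ?thesis using True v_um by (simp add: extension_def)
next
  case False
  let ?P = "\<lambda>l. \<forall>mk p. (\<forall>k. p k \<in> V N (mk k) - V N (mk k - 1)) \<longrightarrow>
    limitin (shift_topology N) p x sequentially \<longrightarrow> (\<lambda>k. um (mk k) (p k)) \<longlonglongrightarrow> l"
  \<comment> \<open>Along any admissible sequence the values of \<open>um\<close> are values of
    \<open>v\<close>, so continuity of \<open>v\<close> supplies the limit.\<close>
  have "?P (v x)"
  proof (intro allI impI)
    fix mk :: "nat \<Rightarrow> nat" and p
    assume p: "\<forall>k. p k \<in> V N (mk k) - V N (mk k - 1)"
      and lim: "limitin (shift_topology N) p x sequentially"
    have "limitin euclideanreal (v \<circ> p) (v x) sequentially"
      by (rule continuous_map_limit[OF v lim])
    moreover have "um (mk k) (p k) = v (p k)" for k using p v_um by (metis DiffD1)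
    ultimately show "(\<lambda>k. um (mk k) (p k)) \<longlonglongrightarrow> v x" by (simp add: o_def)
  qed
  \<comment> \<open>Uniqueness in the definite description requires that some admissible sequence
    converge to \<open>x\<close>; otherwise every \<open>l\<close> would qualify.\<close>
  moreover have "l = v x" if l: "?P l" for l
  proof -
    obtain p where p: "\<And>m. m \<ge> 1 \<Longrightarrow> p m \<in> V N m - V N (m - 1)"
      "limitin (shift_topology N) p x sequentially"
      using approximating_sequence[OF N x] by blast
    \<comment> \<open>The sequence is shifted by one since no vertex is admissible at level
      0.\<close>
    have shifted: "\<forall>k. p (Suc k) \<in> V N (Suc k) - V N (Suc k - 1)"
      using p(1)[of "Suc k" for k] by auto
    have "limitin (shift_topology N) (\<lambda>k. p (Suc k)) x sequentially"
      using limitin_subsequence[of Suc, OF _ p(2)] strict_mono_Suc_iff[of Suc] by (simp add: o_def)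
    then have "(\<lambda>k. um (Suc k) (p (Suc k))) \<longlonglongrightarrow> l'" if "?P l'" for l'
      using that[THEN spec, of Suc, THEN spec, of "\<lambda>k. p (Suc k)"] shifted by blast
    from this[OF l] this[OF \<open>?P (v x)\<close>] show ?thesis by (rule LIMSEQ_unique)
  qed
  ultimately have "(THE l. ?P l) = v x" by (rule the_equality)
  then show ?thesis using False by (simp add: extension_def)
qed

text \<open>On new vertices the cylinder mass and the eigenvalue equation turn the error into
  exactly \<open>(L - N^(m+1) lam m) v p\<close>, which tends to zero uniformly because
  \<open>v\<close> is bounded.\<close>

lemma has_laplacian_limit_function:
  assumes v: "continuous_map (shift_topology N) euclideanreal v"
    and bound: "\<exists>B. \<forall>x\<in>shift_space N. \<bar>v x\<bar> \<le> B"
    and v_um: "\<And>m x. x \<in> V N m \<Longrightarrow> v x = um m x"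
    and u: "\<And>x. x \<in> shift_space N \<Longrightarrow> u x = v x"
    and lim: "(\<lambda>m. real N ^ (m + 1) * lam m) \<longlonglongrightarrow> L"
  shows "has_laplacian N u (\<lambda>x. - L * v x)"
proof -
  obtain B where B: "\<And>x. x \<in> shift_space N \<Longrightarrow> \<bar>v x\<bar> \<le> B" using bound by blast
  let ?d = "\<lambda>m p. \<bar>H N m u p / measure (bernoulli_measure N) (cylinder N (m + 1) p) - - L * v p\<bar>"
  let ?c = "\<lambda>m. L - real N ^ (m + 1) * lam m"
  have d: "?d m p \<le> \<bar>?c m\<bar> * B" if m: "m \<ge> m0" and p: "p \<in> V N m - V N (m - 1)" for m p
  proof -
    \<comment> \<open>A new vertex is interior, as \<open>V N 0\<close> is contained in
      \<open>V N (m - 1)\<close>; hence \<open>H_um\<close> applies.\<close>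
    have ps: "p \<in> shift_space N" "p \<in> V N m - V N 0"
      using p V_subset[of N m] V_mono[of 0 "m - 1" N] by auto
    have um: "u q = um m q" if "q \<in> V N m" for q
      using u[of q] v_um[OF that] that V_subset by auto
    have "H N m u p = H N m (um m) p" using um ps by (intro H_cong) auto
    also have "\<dots> = - lam m * v p" using H_um[OF m ps(2)] v_um[of p m] ps(2) by simp
    finally have "H N m u p = - lam m * v p" .
    then have "?d m p = \<bar>?c m * v p\<bar>"
      using N measure_cylinder[OF _ ps(1), of "m + 1"] by (simp add: algebra_simps)
    then show ?thesis using B[OF ps(1)] by (simp add: abs_mult mult_left_mono)
  qed
  have "(\<lambda>m. MAX p\<in>V N m - V N (m - 1). ?d m p) \<longlonglongrightarrow> 0"
  proof (rule Lim_null_comparison)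
    \<comment> \<open>This point yields a new vertex at each level from 1 on, so that the maximum is
      attained.\<close>
    obtain x where "x \<in> shift_space N"
      using eigenpair V_subset by (auto simp: H_dirichlet_eigenpair_def)
    then obtain q where q: "\<And>m. m \<ge> 1 \<Longrightarrow> q m \<in> V N m - V N (m - 1)"
      using approximating_sequence[OF N] by blast
    show "\<forall>\<^sub>F m in sequentially.
      norm (MAX p\<in>V N m - V N (m - 1). ?d m p) \<le> \<bar>?c m\<bar> * B"
      using eventually_ge_at_top[of m0]
    proof eventually_elim
      case (elim m)
      have "(MAX p\<in>V N m - V N (m - 1). ?d m p) \<in> ?d m ` (V N m - V N (m - 1))"
        using finite_V q[of m] elim m0 by (intro Max_in) auto
      then obtain p where "p \<in> V N m - V N (m - 1)"
        "(MAX p\<in>V N m - V N (m - 1). ?d m p) = ?d m p" by (rule imageE)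
      then show ?case using d[OF elim, of p] by simp
    qed
    have "?c \<longlonglongrightarrow> L - L" by (intro tendsto_diff tendsto_const lim)
    then show "(\<lambda>m. \<bar>?c m\<bar> * B) \<longlonglongrightarrow> 0"
      by (intro tendsto_mult_left_zero tendsto_rabs_zero) simp
  qed
  moreover have "continuous_map (shift_topology N) euclideanreal (\<lambda>x. - L * v x)"
    using v by (intro continuous_map_real_mult continuous_map_const[THEN iffD2]) auto
  ultimately show ?thesis by (simp only: has_laplacian_def)
qed

lemma laplacian_dirichlet_eigenpair_limit:
  assumes u: "\<And>x. x \<in> shift_space N \<Longrightarrow> u x = extension N um x"
    and lim: "(\<lambda>m. real N ^ (m + 1) * lam m) \<longlonglongrightarrow> L"
  shows "laplacian_dirichlet_eigenpair N L u"
proof -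
  obtain v where v: "continuous_map (shift_topology N) euclideanreal v"
      "\<exists>B. \<forall>x\<in>shift_space N. \<bar>v x\<bar> \<le> B"
    and v_um: "\<And>m x. x \<in> V N m \<Longrightarrow> v x = um m x"
    using limit_function by blast
  have uv: "u x = v x" if "x \<in> shift_space N" for x
    using u[OF that] extension_eq[OF v(1) v_um that] by simp
  have lap: "has_laplacian N u (\<lambda>x. - L * v x)"
    by (rule has_laplacian_limit_function[OF v v_um uv lim])
  have "continuous_map (shift_topology N) euclideanreal u"
    using v(1) uv by (auto intro: continuous_map_eq simp: topspace_shift_topology)
  with lap have "u \<in> D_mu N" by (auto simp: D_mu_def)
  moreover have "\<exists>x\<in>shift_space N. u x \<noteq> 0"
    using eigenpair uv v_um V_subset unfolding H_dirichlet_eigenpair_def by (metis subsetD)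
  \<comment> \<open>The chosen \<open>laplacian N u\<close> is identified with
    \<open>- L * v\<close> on the shift space by uniqueness.\<close>
  moreover have "has_laplacian N u (laplacian N u)"
    unfolding laplacian_def using someI[of "has_laplacian N u", OF lap] .
  then have "laplacian N u x = - L * u x" if "x \<in> shift_space N" for x
    using has_laplacian_unique[OF N _ lap that] uv[OF that] by simp
  moreover have "u x = 0" if "x \<in> V N 0" for x
  proof -
    have "x \<in> V N m0" using V_mono[of 0 m0 N] that by auto
    then have "u x = um m0 x" using uv V_subset v_um by (metis subsetD)
    then show ?thesis using eigenpair that by (simp add: H_dirichlet_eigenpair_def)
  qed
  ultimately show ?thesis by (auto simp: laplacian_dirichlet_eigenpair_def)
qed

end

theorem theorem7p1:
  fixes N m0 :: nat
    and lam :: "nat \<Rightarrow> real"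
    and um :: "nat \<Rightarrow> seq \<Rightarrow> real"
    and u :: "seq \<Rightarrow> real"
  assumes "N > 1" and "m0 \<ge> 1"
    and "H_dirichlet_eigenpair N m0 (lam m0) (um m0)"
    and "\<And>m. m > m0 \<Longrightarrow> lam m = (phi_minus N ^^ (m - m0)) (lam m0)"
    and "\<And>m p. m > m0 \<Longrightarrow> p \<in> V N (m - 1) \<Longrightarrow> um m p = um (m - 1) p"
    and "\<And>m p. m > m0 \<Longrightarrow> p \<in> V N m - V N (m - 1) \<Longrightarrow>
           um m p = um (m - 1) (parent m p) / (1 - lam m)"
    and "\<And>m p. m < m0 \<Longrightarrow> p \<in> V N m \<Longrightarrow> um m p = um m0 p"
    and "\<And>x. x \<in> shift_space N \<Longrightarrow> u x = extension N um x"
  shows "\<exists>lambda. (\<lambda>m. real N ^ (m + 1) * lam m) \<longlonglongrightarrow> lambda \<and>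
           laplacian_dirichlet_eigenpair N lambda u"
proof -
  interpret spectral_decimation N m0 lam um
  proof
    fix m assume m: "m \<ge> m0"
    \<comment> \<open>The iterate formula is extended to \<open>m = m0\<close>, where it is the
      identity, so that the one-step recursion also holds there.\<close>
    have "lam m = (phi_minus N ^^ (m - m0)) (lam m0)"
      using assms(4)[of m] m by (cases "m = m0") auto
    then show "lam (Suc m) = phi_minus N (lam m)"
      using assms(4)[of "Suc m"] m by (simp add: Suc_diff_le)
    fix p
    show "um (Suc m) p = um m p" if "p \<in> V N m"
      using assms(5)[of "Suc m" p] that m by simp
    show "um (Suc m) p = um m (parent (Suc m) p) / (1 - lam (Suc m))"
      if "p \<in> V N (Suc m) - V N m"
      using assms(6)[of "Suc m" p] that m by simp
  qed (use assms in auto)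
  show ?thesis
    using renormalized_lam_convergent laplacian_dirichlet_eigenpair_limit assms(8)
    unfolding convergent_def by blast
qed

end
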